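(* There exist acyclic dynamic flow networks with only one capacity change in which every minimum dynamic cut has exponential complexity while there exists a maximum dynamic flow of linear complexity: for every $k\in\mathbb{N}^+$ there is such a network of size polynomial in $k$ in which every minimum cut has complexity exponential in $k$ and some maximum flow has complexity linear in the size of the network. The same is true for static capacities and time-dependent transit times with only one transit time change.
   Context: A dynamic flow network with time-dependent capacities: directed graph $G=(V,E)$, source $s$, target $t$, time horizon $T$, constant transit times $\tau_e\ge0$, capacity functions $u_e\colon[0,T]\to\mathbb{R}_{\ge0}$ with finitely many discontinuities; "one capacity change" means all capacities constant except one edge with a single jump. In the variant with time-dependent transit times, capacities are constant and transit times $\tau_e(\Theta)$ (for flow entering at $\Theta$) are constant except for a single jump of one edge. A dynamic flow is a family of measurable $f_e$ with $f_e\le u_e$, no flow before time $0$ or arriving after $T$, and strong flow conservation at every $v\ne s,t$ at every time; its value is the flow arrived at $t$ by $T$. A dynamic cut is a family $S_v\colon[0,T]\to\{0,1\}$ with $S_s\equiv1$, $S_t\equiv0$, $S_v(\Theta)=1$ for $\Theta>T$, of capacity $\int_0^T\sum_{e=(v,w):S_v(\Theta)=1,S_w(\Theta+\tau_e)=0}u_e(\Theta)d\Theta$. The complexity of a cut is the total number of partition switches of all vertices; the complexity of a flow is the total number of changes of all functions $f_e$. *)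

theory Defs
  imports "HOL-Analysis.Analysis" "HOL-Library.Extended_Nat" "HOL-Library.Extended_Real"
begin

type_synonym edge = "nat \<times> nat"

text \<open>A dynamic flow network. The transit time is given as a function of the
  edge and of the time at which flow enters the edge; for constant transit
  times this function does not depend on the entering time.\<close>
record network =
  verts   :: "nat set"
  edges   :: "edge set"
  src     :: nat
  snk     :: nat
  horizon :: real
  transit :: "edge \<Rightarrow> real \<Rightarrow> real"
  cap     :: "edge \<Rightarrow> real \<Rightarrow> real"

definition wf_network :: "network \<Rightarrow> bool" where
  "wf_network N \<longleftrightarrow>
     finite (verts N) \<and> edges N \<subseteq> verts N \<times> verts N \<and>
     src N \<in> verts N \<and> snk N \<in> verts N \<and> src N \<noteq> snk N \<and> horizon N > 0 \<and>
     (\<forall>e\<in>edges N. \<forall>\<Theta>. transit N e \<Theta> \<ge> 0) \<and>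
     (\<forall>e\<in>edges N. \<forall>\<Theta>\<in>{0..horizon N}. cap N e \<Theta> \<ge> 0) \<and>
     (\<forall>e\<in>edges N. finite {\<Theta>\<in>{0..horizon N}.
          \<not> continuous (at \<Theta> within {0..horizon N}) (cap N e)})"

definition arrivals :: "network \<Rightarrow> (edge \<Rightarrow> real \<Rightarrow> real) \<Rightarrow> edge \<Rightarrow> real \<Rightarrow> real" where
  "arrivals N f e \<theta> = (\<Sum>\<Theta>\<in>{\<Theta>. \<Theta> + transit N e \<Theta> = \<theta>}. f e \<Theta>)"

definition inflow :: "network \<Rightarrow> (edge \<Rightarrow> real \<Rightarrow> real) \<Rightarrow> nat \<Rightarrow> real \<Rightarrow> real" where
  "inflow N f v \<theta> = (\<Sum>e\<in>{e\<in>edges N. snd e = v}. arrivals N f e \<theta>)"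

definition outflow :: "network \<Rightarrow> (edge \<Rightarrow> real \<Rightarrow> real) \<Rightarrow> nat \<Rightarrow> real \<Rightarrow> real" where
  "outflow N f v \<theta> = (\<Sum>e\<in>{e\<in>edges N. fst e = v}. f e \<theta>)"

definition dynamic_flow :: "network \<Rightarrow> (edge \<Rightarrow> real \<Rightarrow> real) \<Rightarrow> bool" where
  "dynamic_flow N f \<longleftrightarrow>
     (\<forall>e\<in>edges N. f e \<in> borel_measurable lebesgue) \<and>
     (\<forall>e\<in>edges N. \<forall>\<Theta>. 0 \<le> f e \<Theta>) \<and>
     (\<forall>e\<in>edges N. \<forall>\<Theta>\<in>{0..horizon N}. f e \<Theta> \<le> cap N e \<Theta>) \<and>
     (\<forall>e\<in>edges N. \<forall>\<Theta><0. f e \<Theta> = 0) \<and>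
     (\<forall>e\<in>edges N. \<forall>\<Theta>. \<Theta> + transit N e \<Theta> > horizon N \<longrightarrow> f e \<Theta> = 0) \<and>
     (\<forall>v\<in>verts N - {src N, snk N}. \<forall>\<theta>. inflow N f v \<theta> = outflow N f v \<theta>)"

definition flow_value :: "network \<Rightarrow> (edge \<Rightarrow> real \<Rightarrow> real) \<Rightarrow> real" where
  "flow_value N f =
     (\<Sum>e\<in>{e\<in>edges N. snd e = snk N}. (LINT \<Theta>|lebesgue. f e \<Theta>))
   - (\<Sum>e\<in>{e\<in>edges N. fst e = snk N}. (LINT \<Theta>|lebesgue. f e \<Theta>))"

definition max_flow :: "network \<Rightarrow> (edge \<Rightarrow> real \<Rightarrow> real) \<Rightarrow> bool" where
  "max_flow N f \<longleftrightarrow> dynamic_flow N f \<and>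
     (\<forall>g. dynamic_flow N g \<longrightarrow> flow_value N g \<le> flow_value N f)"

text \<open>Dynamic cut: S v \<Theta> = True means v is on the source side at time \<Theta>.\<close>
definition dynamic_cut :: "network \<Rightarrow> (nat \<Rightarrow> real \<Rightarrow> bool) \<Rightarrow> bool" where
  "dynamic_cut N S \<longleftrightarrow>
     (\<forall>\<Theta>\<in>{0..horizon N}. S (src N) \<Theta>) \<and>
     (\<forall>\<Theta>\<in>{0..horizon N}. \<not> S (snk N) \<Theta>) \<and>
     (\<forall>v. \<forall>\<Theta>>horizon N. S v \<Theta>) \<and>
     (\<forall>v\<in>verts N. {\<Theta>. S v \<Theta>} \<in> sets lebesgue)"

definition cut_capacity :: "network \<Rightarrow> (nat \<Rightarrow> real \<Rightarrow> bool) \<Rightarrow> real" where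
  "cut_capacity N S =
     (LINT \<Theta>:{0..horizon N}|lebesgue.
        (\<Sum>e\<in>{e\<in>edges N. S (fst e) \<Theta> \<and> \<not> S (snd e) (\<Theta> + transit N e \<Theta>)}. cap N e \<Theta>))"

definition min_cut :: "network \<Rightarrow> (nat \<Rightarrow> real \<Rightarrow> bool) \<Rightarrow> bool" where
  "min_cut N S \<longleftrightarrow> dynamic_cut N S \<and>
     (\<forall>S'. dynamic_cut N S' \<longrightarrow> cut_capacity N S \<le> cut_capacity N S')"

definition change_points :: "(real \<Rightarrow> 'a) \<Rightarrow> real set \<Rightarrow> real set" where
  "change_points g A = {\<theta>\<in>A. \<forall>\<epsilon>>0. \<exists>x y. \<bar>x - \<theta>\<bar> < \<epsilon> \<and> \<bar>y - \<theta>\<bar> < \<epsilon> \<and> g x \<noteq> g y}"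

definition num_changes :: "(real \<Rightarrow> 'a) \<Rightarrow> real set \<Rightarrow> enat" where
  "num_changes g A = (if finite (change_points g A) then enat (card (change_points g A)) else \<infinity>)"

definition cut_complexity :: "network \<Rightarrow> (nat \<Rightarrow> real \<Rightarrow> bool) \<Rightarrow> enat" where
  "cut_complexity N S = (\<Sum>v\<in>verts N. num_changes (S v) {0<..<horizon N})"

definition flow_complexity :: "network \<Rightarrow> (edge \<Rightarrow> real \<Rightarrow> real) \<Rightarrow> enat" where
  "flow_complexity N f = (\<Sum>e\<in>edges N. num_changes (f e) UNIV)"

definition net_size :: "network \<Rightarrow> nat" where
  "net_size N = card (verts N) + card (edges N)"

definition one_capacity_change :: "network \<Rightarrow> bool" where
  "one_capacity_change N \<longleftrightarrow>
     (\<forall>e\<in>edges N. \<exists>c. \<forall>\<Theta>. transit N e \<Theta> = c) \<and>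
     (\<exists>e0\<in>edges N. \<exists>a b \<theta>0. a \<noteq> b \<and> 0 < \<theta>0 \<and> \<theta>0 < horizon N \<and>
        (\<forall>\<Theta>. cap N e0 \<Theta> = (if \<Theta> < \<theta>0 then a else b)) \<and>
        (\<forall>e\<in>edges N - {e0}. \<exists>c. \<forall>\<Theta>. cap N e \<Theta> = c))"

definition one_transit_change :: "network \<Rightarrow> bool" where
  "one_transit_change N \<longleftrightarrow>
     (\<forall>e\<in>edges N. \<exists>c. \<forall>\<Theta>. cap N e \<Theta> = c) \<and>
     (\<exists>e0\<in>edges N. \<exists>a b \<theta>0. a \<noteq> b \<and> 0 < \<theta>0 \<and> \<theta>0 < horizon N \<and>
        (\<forall>\<Theta>. transit N e0 \<Theta> = (if \<Theta> < \<theta>0 then a else b)) \<and>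
        (\<forall>e\<in>edges N - {e0}. \<exists>c. \<forall>\<Theta>. transit N e \<Theta> = c))"

definition exp_min_cuts_lin_max_flow :: "(network \<Rightarrow> bool) \<Rightarrow> bool" where
  "exp_min_cuts_lin_max_flow P \<longleftrightarrow>
     (\<exists>Nk :: nat \<Rightarrow> network. \<exists>p d :: nat. \<exists>c b C :: real. c > 0 \<and> b > 1 \<and>
        (\<forall>k\<ge>1. wf_network (Nk k) \<and> acyclic (edges (Nk k)) \<and> P (Nk k) \<and>
           net_size (Nk k) \<le> p * k ^ d + p \<and>
           (\<exists>S. min_cut (Nk k) S) \<and>
           (\<forall>S. min_cut (Nk k) S \<longrightarrow>
                ereal_of_enat (cut_complexity (Nk k) S) \<ge> ereal (c * b ^ k)) \<and>
           (\<exists>f. max_flow (Nk k) f \<and>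
                ereal_of_enat (flow_complexity (Nk k) f) \<le> ereal (C * real (net_size (Nk k))))))"

end

theory Submission
  imports Defs
begin

text \<open>
  Vertices \<open>u\<^sub>0, \<dots>, u\<^sub>2\<^sub>k\<close> form a chain in which consecutive vertices are joined by a route of
  transit time \<open>0\<close> and one of transit time a power of two: \<open>2, 4, \<dots>, 2\<^sup>k\<close> on the first half,
  mirrored on the second half. The chain carries no flow in the maximum flow, so by complementary
  slackness no minimum cut separates it: if \<open>u\<^sub>i\<close> is on the source side, so is everything reached
  from it along the chain. With \<open>h = 2 \<cdot> 2\<^sup>k\<close>, the network around the chain forces \<open>u\<^sub>0\<close> to the source
  side during \<open>(h - 1, h)\<close>, hence \<open>u\<^sub>k\<close> to the source side during \<open>(h - 1, h) + 2j\<close> for all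
  \<open>j < 2\<^sup>k\<close>; and it forces \<open>u\<^sub>2\<^sub>k\<close> to the sink side during the last half time unit, hence \<open>u\<^sub>k\<close> to
  the sink side during \<open>(h, h + 1/2) + 2j\<close>. So \<open>u\<^sub>k\<close> switches at least \<open>2\<^sup>k\<close> times, while the
  maximum flow only uses the six edges outside the chain, each during one interval.

  Both windows stem from a single event, the edge from the source to vertex \<open>1\<close> becoming useless
  at time \<open>h\<close>: either its capacity drops to \<open>0\<close>, or its transit time exceeds the horizon from
  then on. The other end of each window is due to flow that cannot arrive before its transit time
  has elapsed, or to the time horizon.
\<close>

section \<open>Translations of Lebesgue measure, and arrivals under a jumping transit time\<close>

lemma lebesgue_translate:
  fixes F :: "real \<Rightarrow> real"
  assumes "integrable lebesgue F"
  shows "integrable lebesgue (\<lambda>x. F (x - a))"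
    and "(LINT x|lebesgue. F (x - a)) = (LINT x|lebesgue. F x)"
proof -
  have "has_bochner_integral lebesgue F (integral\<^sup>L lebesgue F)"
    using assms by (simp add: has_bochner_integral_iff)
  then have "has_bochner_integral lebesgue (\<lambda>x. F (- a + 1 * x)) (integral\<^sup>L lebesgue F /\<^sub>R \<bar>1\<bar>)"
    by (subst (asm) has_bochner_integral_lebesgue_real_affine_iff[of 1 _ _ "- a"]) simp_all
  then have "has_bochner_integral lebesgue (\<lambda>x. F (x - a)) (integral\<^sup>L lebesgue F)"
    by simp
  then show "integrable lebesgue (\<lambda>x. F (x - a))"
    and "(LINT x|lebesgue. F (x - a)) = (LINT x|lebesgue. F x)"
    by (simp_all add: has_bochner_integral_iff)
qed

text \<open>Carries almost-everywhere statements between departure and arrival times.\<close>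

lemma AE_lebesgue_translate:
  fixes a :: real
  assumes "AE x in lebesgue. P x"
  shows "AE x in lebesgue. P (x + a)"
proof -
  obtain N where N: "N \<in> null_sets lborel" "{x. \<not> P x} \<subseteq> N"
    using assms[unfolded AE_completion_iff] by (auto simp: eventually_ae_filter)
  have "{x. x - (- a) \<in> N} \<in> null_sets lborel"
    using null_sets_translation[OF N(1)] .
  then have "AE x in lborel. P (x + a)"
    using N(2) by (intro AE_I'[of "{x. x - (- a) \<in> N}"]) auto
  then show ?thesis by (simp add: AE_completion_iff)
qed

lemma lebesgue_vimage_translate:
  fixes d :: real
  assumes "A \<in> sets lebesgue"
  shows "(\<lambda>x. x + d) -` A \<in> sets lebesgue"
proof -
  have "(\<lambda>x. x + d) -` A = (+) (- d) ` A"
    by (force simp: image_iff)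
  then show ?thesis using lebesgue_sets_translation[OF assms, of "- d"] by simp
qed

text \<open>At most two departures share an arrival time, one before the jump and one after it, so
  the sum in \<open>arrivals\<close> ranges over a finite set.\<close>

lemma arrivals_jump:
  assumes "\<And>\<Theta>. transit N e \<Theta> = (if \<Theta> < \<theta>0 then a else b)"
  shows "arrivals N f e \<theta> = (if \<theta> - a < \<theta>0 then f e (\<theta> - a) else 0) +
           (if \<theta> - b \<ge> \<theta>0 then f e (\<theta> - b) else 0)"
proof -
  have "{\<Theta>. \<Theta> + transit N e \<Theta> = \<theta>} =
      (if \<theta> - a < \<theta>0 then {\<theta> - a} else {}) \<union> (if \<theta> - b \<ge> \<theta>0 then {\<theta> - b} else {})"
    by (auto simp: assms split: if_splits)
  moreover have "\<theta> - a < \<theta>0 \<Longrightarrow> \<theta> - b \<ge> \<theta>0 \<Longrightarrow> \<theta> - a \<noteq> \<theta> - b"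
    by linarith
  ultimately show ?thesis
    by (auto simp: arrivals_def)
qed

lemma arrivals_const:
  assumes "\<And>\<Theta>. transit N e \<Theta> = a"
  shows "arrivals N f e \<theta> = f e (\<theta> - a)"
  using arrivals_jump[of N e 0 a a f \<theta>] assms by simp

section \<open>Weak duality and complementary slackness\<close>

definition duality_gap :: "network \<Rightarrow> (nat \<Rightarrow> real \<Rightarrow> bool) \<Rightarrow> (edge \<Rightarrow> real \<Rightarrow> real) \<Rightarrow> edge \<Rightarrow> real \<Rightarrow> real" where
  "duality_gap N S f e \<Theta> =
     (if \<Theta> \<notin> {0..horizon N} then 0
      else if S (fst e) \<Theta> \<and> \<not> S (snd e) (\<Theta> + transit N e \<Theta>) then cap N e \<Theta> - f e \<Theta>
      else if \<not> S (fst e) \<Theta> \<and> S (snd e) (\<Theta> + transit N e \<Theta>) then f e \<Theta>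
      else 0)"

text \<open>A constant transit time is a jump with \<open>a = b\<close>, so one duality theory
  covers both variants.\<close>

locale jump_network =
  fixes N :: network
  assumes wf: "wf_network N"
    and transit_jump: "\<And>e. e \<in> edges N \<Longrightarrow>
      \<exists>a b \<theta>0. \<forall>\<Theta>. transit N e \<Theta> = (if \<Theta> < \<theta>0 then a else b)"
    and cap_integrable: "\<And>e. e \<in> edges N \<Longrightarrow> set_integrable lebesgue {0..horizon N} (cap N e)"
begin

lemma finite_verts: "finite (verts N)" and finite_edges: "finite (edges N)"
  and edge_verts: "e \<in> edges N \<Longrightarrow> fst e \<in> verts N \<and> snd e \<in> verts N"
  and transit_nonneg: "e \<in> edges N \<Longrightarrow> transit N e \<Theta> \<ge> 0"
  and src_snk: "src N \<in> verts N" "snk N \<in> verts N" "src N \<noteq> snk N"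
  using wf finite_subset[of "edges N" "verts N \<times> verts N"] by (auto simp: wf_network_def)

context
  fixes f assumes flow: "dynamic_flow N f"
begin

lemma flow_outside:
  assumes "e \<in> edges N" "f e \<Theta> \<noteq> 0"
  shows "0 \<le> \<Theta>" "\<Theta> + transit N e \<Theta> \<le> horizon N" "\<Theta> \<le> horizon N"
proof -
  show 1: "0 \<le> \<Theta>" "\<Theta> + transit N e \<Theta> \<le> horizon N"
    using flow assms unfolding dynamic_flow_def by (meson not_le)+
  show "\<Theta> \<le> horizon N" using 1 transit_nonneg[OF assms(1), of \<Theta>] by linarith
qed

lemma flow_integrable:
  assumes "e \<in> edges N"
  shows "integrable lebesgue (f e)"
proof (rule Bochner_Integration.integrable_bound)
  show "integrable lebesgue (\<lambda>x. indicator {0..horizon N} x *\<^sub>R cap N e x)"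
    using cap_integrable[OF assms] by (simp add: set_integrable_def)
  show "f e \<in> borel_measurable lebesgue"
    using flow assms by (auto simp: dynamic_flow_def)
  show "AE x in lebesgue. norm (f e x) \<le> norm (indicator {0..horizon N} x *\<^sub>R cap N e x)"
  proof (intro AE_I2)
    fix x
    show "norm (f e x) \<le> norm (indicator {0..horizon N} x *\<^sub>R cap N e x)"
    proof (cases "f e x = 0")
      case False
      then have "x \<in> {0..horizon N}" using flow_outside[OF assms] by auto
      moreover have "0 \<le> f e x" "f e x \<le> cap N e x"
        using flow assms calculation by (auto simp: dynamic_flow_def)
      ultimately show ?thesis by simp
    qed simp
  qed
qed

text \<open>Substitution of the departure time for the arrival time. The arrival time need not be
  injective in the departure time, so the integral is split at the jump into two translates.
  \<open>A\<close> will be the set of times at which the head of the edge is on the sink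
  side.\<close>

lemma arrivals_integral:
  assumes e: "e \<in> edges N" and A: "A \<in> sets lebesgue"
  shows "integrable lebesgue (\<lambda>\<theta>. indicator A \<theta> * arrivals N f e \<theta>)"
    and "(LINT \<theta>|lebesgue. indicator A \<theta> * arrivals N f e \<theta>) =
         (LINT \<Theta>|lebesgue. indicator A (\<Theta> + transit N e \<Theta>) * f e \<Theta>)"
    and "integrable lebesgue (\<lambda>\<Theta>. indicator A (\<Theta> + transit N e \<Theta>) * f e \<Theta>)"
proof -
  obtain a b \<theta>0 where tr: "\<And>\<Theta>. transit N e \<Theta> = (if \<Theta> < \<theta>0 then a else b)"
    using transit_jump[OF e] by blast
  have shift: "(\<lambda>x. x + d) -` A \<in> sets lebesgue" for d :: real
    using lebesgue_vimage_translate[OF A] .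
  define F where "F D d = (\<lambda>\<Theta>. f e \<Theta> * indicator (D \<inter> (\<lambda>x. x + d) -` A) \<Theta>)" for D and d :: real
  have F: "integrable lebesgue (F {..<\<theta>0} a)" "integrable lebesgue (F {\<theta>0..} b)"
    unfolding F_def
    by (intro integrable_real_mult_indicator flow_integrable e sets.Int shift; simp)+
  have eq1: "(\<lambda>\<theta>. indicator A \<theta> * arrivals N f e \<theta>) =
             (\<lambda>\<theta>. F {..<\<theta>0} a (\<theta> - a) + F {\<theta>0..} b (\<theta> - b))"
    by (rule ext) (auto simp: arrivals_jump[OF tr] F_def indicator_def)
  have eq2: "(\<lambda>\<Theta>. indicator A (\<Theta> + transit N e \<Theta>) * f e \<Theta>) = 
             (\<lambda>\<Theta>. F {..<\<theta>0} a \<Theta> + F {\<theta>0..} b \<Theta>)"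
    by (rule ext) (auto simp: tr F_def indicator_def)
  show "integrable lebesgue (\<lambda>\<theta>. indicator A \<theta> * arrivals N f e \<theta>)"
    "integrable lebesgue (\<lambda>\<Theta>. indicator A (\<Theta> + transit N e \<Theta>) * f e \<Theta>)"
    unfolding eq1 eq2 using F lebesgue_translate(1) by (intro Bochner_Integration.integrable_add; blast)+
  show "(LINT \<theta>|lebesgue. indicator A \<theta> * arrivals N f e \<theta>) =
         (LINT \<Theta>|lebesgue. indicator A (\<Theta> + transit N e \<Theta>) * f e \<Theta>)"
    unfolding eq1 eq2 using F by (simp add: lebesgue_translate)
qed

lemma duality_gap_nonneg:
  assumes "e \<in> edges N"
  shows "0 \<le> duality_gap N S f e \<Theta>"
  using flow assms by (auto simp: duality_gap_def dynamic_flow_def)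

text \<open>Pointwise the gap is \<open>U - (I - J)\<close>: the capacity of the edge while it is
  cut, minus the flow arriving while the head is on the sink side, plus the flow leaving while the
  tail is. Regrouped by vertices, \<open>I\<close> and \<open>J\<close> give the net flow
  \<open>X v\<close> that \<open>v\<close> receives while on the sink side. This is zero at inner
  vertices by conservation and at the source, which is never there within the horizon; at the sink
  it is the flow value.\<close>

lemma duality_gap:
  assumes cut: "dynamic_cut N S"
  shows "cut_capacity N S - flow_value N f = (\<Sum>e\<in>edges N. LINT \<Theta>|lebesgue. duality_gap N S f e \<Theta>)"
    and "\<And>e. e \<in> edges N \<Longrightarrow> integrable lebesgue (duality_gap N S f e)"
proof -
  define H where "H v = {\<theta>. \<not> S v \<theta>}" for v
  have H: "H v \<in> sets lebesgue" if "v \<in> verts N" for v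
  proof -
    have "UNIV - {\<theta>. S v \<theta>} \<in> sets lebesgue"
      using cut that by (intro sets.Diff) (auto simp: dynamic_cut_def)
    moreover have "UNIV - {\<theta>. S v \<theta>} = H v" by (auto simp: H_def)
    ultimately show ?thesis by simp
  qed
  have Hedge: "H (fst e) \<in> sets lebesgue" "H (snd e) \<in> sets lebesgue" if "e \<in> edges N" for e
    using H edge_verts[OF that] by auto
  define I where "I e = (\<lambda>\<Theta>. indicat_real (H (snd e)) (\<Theta> + transit N e \<Theta>) * f e \<Theta>)" for e
  define J where "J e = (\<lambda>\<Theta>. indicat_real (H (fst e)) \<Theta> * f e \<Theta>)" for e
  define U where "U e = (\<lambda>\<Theta>. if \<Theta> \<in> {0..horizon N} \<and> S (fst e) \<Theta> \<and> \<not> S (snd e) (\<Theta> + transit N e \<Theta>)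
      then cap N e \<Theta> else 0)" for e
  have intI: "integrable lebesgue (I e)" if "e \<in> edges N" for e
    unfolding I_def by (rule arrivals_integral) (use that Hedge in auto)
  have intJ: "integrable lebesgue (J e)" if "e \<in> edges N" for e
    unfolding J_def
    using integrable_real_mult_indicator[OF Hedge(1)[OF that] flow_integrable[OF that]]
    by (simp add: mult.commute)
  have intU: "integrable lebesgue (U e)" if e: "e \<in> edges N" for e
  proof -
    obtain a b \<theta>0 where tr: "\<And>\<Theta>. transit N e \<Theta> = (if \<Theta> < \<theta>0 then a else b)"
      using transit_jump[OF e] by blast
    have shift: "(\<lambda>x. x + d) -` H (snd e) \<in> sets lebesgue" for d :: real
      using lebesgue_vimage_translate[OF Hedge(2)[OF e]] .
    \<comment> \<open>The departure times at which the edge crosses the cut, split at the jump so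
      that only translates of measurable sets occur.\<close>
    define D where "D = (UNIV - H (fst e)) \<inter>
      (({..<\<theta>0} \<inter> (\<lambda>x. x + a) -` H (snd e)) \<union> ({\<theta>0..} \<inter> (\<lambda>x. x + b) -` H (snd e)))"
    have "D \<in> sets lebesgue"
      unfolding D_def
      by (intro sets.Int sets.Un sets.Diff shift Hedge e) auto
    moreover have "U e = (\<lambda>\<Theta>. (indicat_real {0..horizon N} \<Theta> *\<^sub>R cap N e \<Theta>) * indicat_real D \<Theta>)"
      by (rule ext) (auto simp: U_def D_def H_def tr indicator_def)
    ultimately show ?thesis
      using integrable_real_mult_indicator cap_integrable[OF e] by (simp add: set_integrable_def)
  qed
  have gap: "duality_gap N S f e = (\<lambda>\<Theta>. U e \<Theta> - (I e \<Theta> - J e \<Theta>))" if e: "e \<in> edges N" for e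
  proof
    fix \<Theta>
    have "\<Theta> \<in> {0..horizon N} \<or> f e \<Theta> = 0"
      using flow_outside[OF e] by auto
    then show "duality_gap N S f e \<Theta> = U e \<Theta> - (I e \<Theta> - J e \<Theta>)"
      by (auto simp: duality_gap_def U_def I_def J_def H_def)
  qed
  show "\<And>e. e \<in> edges N \<Longrightarrow> integrable lebesgue (duality_gap N S f e)"
    using intI intJ intU by (simp add: gap)
  have capU: "cut_capacity N S = (\<Sum>e\<in>edges N. integral\<^sup>L lebesgue (U e))"
  proof -
    have "indicat_real {0..horizon N} \<Theta> *\<^sub>R
      (\<Sum>e\<in>{e \<in> edges N. S (fst e) \<Theta> \<and> \<not> S (snd e) (\<Theta> + transit N e \<Theta>)}. cap N e \<Theta>)
      = (\<Sum>e\<in>edges N. U e \<Theta>)" for \<Theta>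
      using finite_edges by (cases "\<Theta> \<in> {0..horizon N}") (auto simp: U_def sum.inter_filter intro!: sum.cong)
    then have "cut_capacity N S = (LINT \<Theta>|lebesgue. (\<Sum>e\<in>edges N. U e \<Theta>))"
      by (simp add: cut_capacity_def set_lebesgue_integral_def)
    also have "\<dots> = (\<Sum>e\<in>edges N. integral\<^sup>L lebesgue (U e))"
      by (intro Bochner_Integration.integral_sum intU)
    finally show ?thesis .
  qed
  let ?i = "\<lambda>e. integral\<^sup>L lebesgue (I e)" and ?j = "\<lambda>e. integral\<^sup>L lebesgue (J e)"
  define X where "X v = (\<Sum>e | e \<in> edges N \<and> snd e = v. ?i e) - (\<Sum>e | e \<in> edges N \<and> fst e = v. ?j e)" for v
  have inner: "X v = 0" if v: "v \<in> verts N - {src N, snk N}" for v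
  proof -
    have "(\<Sum>e | e \<in> edges N \<and> snd e = v. ?i e) =
      (\<Sum>e | e \<in> edges N \<and> snd e = v. LINT \<theta>|lebesgue. indicator (H v) \<theta> * arrivals N f e \<theta>)"
      using v H by (intro sum.cong) (auto simp: I_def arrivals_integral(2))
    also have "\<dots> = (LINT \<theta>|lebesgue. indicator (H v) \<theta> * inflow N f v \<theta>)"
      unfolding inflow_def sum_distrib_left
      using v H by (intro Bochner_Integration.integral_sum[symmetric] arrivals_integral(1)) auto
    also have "\<dots> = (LINT \<theta>|lebesgue. indicator (H v) \<theta> * outflow N f v \<theta>)"
      using flow v by (simp add: dynamic_flow_def)
    also have "\<dots> = (\<Sum>e | e \<in> edges N \<and> fst e = v. LINT \<theta>|lebesgue. indicator (H v) \<theta> * f e \<theta>)"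
      unfolding outflow_def sum_distrib_left
      using intJ by (intro Bochner_Integration.integral_sum) (auto simp: J_def)
    also have "\<dots> = (\<Sum>e | e \<in> edges N \<and> fst e = v. ?j e)"
      by (intro sum.cong) (auto simp: J_def)
    finally show ?thesis by (simp add: X_def)
  qed
  \<comment> \<open>A cut may do anything before time 0. Flow departs and arrives only within the
    horizon, where the sides of source and sink are fixed.\<close>
  have arr: "\<Theta> \<in> {0..horizon N} \<and> \<Theta> + transit N e \<Theta> \<in> {0..horizon N} \<or> f e \<Theta> = 0"
    if e: "e \<in> edges N" for e \<Theta>
    using flow_outside[OF e] transit_nonneg[OF e, of \<Theta>] by fastforce
  have side: "\<theta> \<notin> H (src N)" "\<theta> \<in> H (snk N)" if "\<theta> \<in> {0..horizon N}" for \<theta>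
    using cut that by (auto simp: dynamic_cut_def H_def)
  have "I e = (\<lambda>_. 0)" if "e \<in> edges N" "snd e = src N" for e
    using arr[OF that(1)] side(1) by (fastforce simp: I_def that indicator_def)
  moreover have "J e = (\<lambda>_. 0)" if "e \<in> edges N" "fst e = src N" for e
    using arr[OF that(1)] side(1) by (fastforce simp: J_def that indicator_def)
  ultimately have Xsrc: "X (src N) = 0"
    by (simp add: X_def)
  have "I e = f e" if "e \<in> edges N" "snd e = snk N" for e
    using arr[OF that(1)] side(2) by (fastforce simp: I_def that indicator_def)
  moreover have "J e = f e" if "e \<in> edges N" "fst e = snk N" for e
    using arr[OF that(1)] side(2) by (fastforce simp: J_def that indicator_def)
  ultimately have Xsnk: "X (snk N) = flow_value N f"
    by (simp add: X_def flow_value_def)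
  have "(\<Sum>v\<in>verts N. X v) = (\<Sum>v\<in>{snk N}. X v)"
    using finite_verts src_snk inner Xsrc by (intro sum.mono_neutral_right) auto
  then have "flow_value N f = (\<Sum>v\<in>verts N. X v)"
    using Xsnk by simp
  also have "\<dots> = (\<Sum>e\<in>edges N. ?i e) - (\<Sum>e\<in>edges N. ?j e)"
    unfolding X_def sum_subtractf
    using finite_verts finite_edges edge_verts by (subst (1 2) sum.group) auto
  finally show "cut_capacity N S - flow_value N f = (\<Sum>e\<in>edges N. LINT \<Theta>|lebesgue. duality_gap N S f e \<Theta>)"
    using intI intJ intU by (simp add: gap capU sum_subtractf)
qed

lemma weak_duality:
  assumes "dynamic_cut N S"
  shows "flow_value N f \<le> cut_capacity N S"
proof -
  have "0 \<le> (\<Sum>e\<in>edges N. LINT \<Theta>|lebesgue. duality_gap N S f e \<Theta>)"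
    using duality_gap_nonneg by (intro sum_nonneg Bochner_Integration.integral_nonneg)
  then show ?thesis using duality_gap(1)[OF assms] by linarith
qed

text \<open>The gap integrals are nonnegative and add up to zero, so each is zero, and a nonnegative
  integrand with zero integral vanishes almost everywhere.\<close>

lemma complementary_slackness:
  assumes "dynamic_cut N S" "cut_capacity N S \<le> flow_value N f" "e \<in> edges N"
  shows "AE \<Theta> in lebesgue. duality_gap N S f e \<Theta> = 0"
proof -
  have nn: "0 \<le> (LINT \<Theta>|lebesgue. duality_gap N S f e \<Theta>)" if "e \<in> edges N" for e
    using duality_gap_nonneg[OF that] by (intro Bochner_Integration.integral_nonneg)
  have "(\<Sum>e\<in>edges N. LINT \<Theta>|lebesgue. duality_gap N S f e \<Theta>) = 0"
    using duality_gap(1)[OF assms(1)] assms(2) weak_duality[OF assms(1)] by simp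
  then have "(LINT \<Theta>|lebesgue. duality_gap N S f e \<Theta>) = 0"
    using sum_nonneg_eq_0_iff[OF finite_edges nn] assms(3) by auto
  then show ?thesis
    using integral_nonneg_eq_0_iff_AE[OF duality_gap(2)[OF assms(1,3)]]
      duality_gap_nonneg[OF assms(3)] by auto
qed

lemma optimal_if_no_gap:
  assumes "dynamic_cut N S" "\<And>e \<Theta>. e \<in> edges N \<Longrightarrow> duality_gap N S f e \<Theta> = 0"
  shows "cut_capacity N S = flow_value N f"
  using duality_gap(1)[OF assms(1)] assms(2) by simp

end
end

section \<open>Change points\<close>

text \<open>Without a change point, \<open>g\<close> would be locally constant on a connected
  interval and therefore constant.\<close>

lemma change_point_between:
  assumes "x < y" "g x \<noteq> g y" "{x..y} \<subseteq> A"
  obtains \<theta> where "\<theta> \<in> change_points g A" "\<theta> \<in> {x..y}"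
proof -
  have "\<exists>\<theta>\<in>{x..y}. \<theta> \<in> change_points g A"
  proof (rule ccontr)
    assume no: "\<not> ?thesis"
    have "\<forall>z\<in>{x..y}. eventually (\<lambda>w. g z = g w) (at z within {x..y})"
    proof
      fix z assume z: "z \<in> {x..y}"
      then have "z \<notin> change_points g A" "z \<in> A" using no assms(3) by auto
      then obtain \<epsilon> where \<epsilon>: "\<epsilon> > 0" "\<And>v w. \<bar>v - z\<bar> < \<epsilon> \<Longrightarrow> \<bar>w - z\<bar> < \<epsilon> \<Longrightarrow> g v = g w"
        unfolding change_points_def by auto
      then show "eventually (\<lambda>w. g z = g w) (at z within {x..y})"
        unfolding eventually_at dist_real_def
        by (intro exI[of _ \<epsilon>]) (metis abs_zero cancel_comm_monoid_add_class.diff_cancel)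
    qed
    from connected_local_const[OF connected_Icc _ _ this, of x y] assms show False by auto
  qed
  then show thesis using that by auto
qed

lemma num_changes_ge:
  fixes n :: nat
  assumes "\<And>j. j < n \<Longrightarrow> \<exists>\<theta>\<in>change_points g A. \<theta> \<in> B j"
    and "disjoint_family_on B {..<n}"
  shows "enat n \<le> num_changes g A"
proof (cases "finite (change_points g A)")
  case True
  from assms(1) obtain p where p: "\<And>j. j < n \<Longrightarrow> p j \<in> change_points g A \<and> p j \<in> B j"
    by metis
  have "inj_on p {..<n}"
  proof (rule inj_onI)
    fix i j assume "i \<in> {..<n}" "j \<in> {..<n}" "p i = p j"
    then show "i = j" using p[of i] p[of j] assms(2) by (auto simp: disjoint_family_on_def)
  qed
  then have "n \<le> card (change_points g A)"
    using card_inj_on_le[of p "{..<n}" "change_points g A"] p True by auto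
  then show ?thesis using True by (simp add: num_changes_def)
qed (simp add: num_changes_def)

text \<open>The values at \<open>a\<close> and \<open>b\<close> are left free so that open, closed,
  half-open and, with \<open>a = b\<close>, empty intervals are all covered.\<close>

lemma change_points_bump:
  assumes "\<And>\<Theta>. \<Theta> < a \<Longrightarrow> g \<Theta> = c" "\<And>\<Theta>. a < \<Theta> \<Longrightarrow> \<Theta> < b \<Longrightarrow> g \<Theta> = d" "\<And>\<Theta>. b < \<Theta> \<Longrightarrow> g \<Theta> = c"
  shows "change_points g A \<subseteq> {a, b}"
proof
  fix \<theta> assume \<theta>: "\<theta> \<in> change_points g A"
  show "\<theta> \<in> {a, b}"
  proof (rule ccontr)
    assume "\<theta> \<notin> {a, b}"
    define \<epsilon> where "\<epsilon> = min \<bar>\<theta> - a\<bar> \<bar>\<theta> - b\<bar>"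
    have "\<epsilon> > 0" using \<open>\<theta> \<notin> {a, b}\<close> by (auto simp: \<epsilon>_def)
    then obtain x y where "\<bar>x - \<theta>\<bar> < \<epsilon>" "\<bar>y - \<theta>\<bar> < \<epsilon>" "g x \<noteq> g y"
      using \<theta> by (auto simp: change_points_def)
    moreover have "\<exists>w. \<forall>z. \<bar>z - \<theta>\<bar> < \<epsilon> \<longrightarrow> g z = w"
    proof -
      consider "\<theta> > b" | "\<theta> < a" | "a < \<theta>" "\<theta> < b"
        using \<open>\<theta> \<notin> {a, b}\<close> by fastforce
      then show ?thesis
      proof cases
        case 1
        then have "\<forall>z. \<bar>z - \<theta>\<bar> < \<epsilon> \<longrightarrow> z > b" by (auto simp: \<epsilon>_def)
        then show ?thesis using assms by blast
      next
        case 2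
        then have "\<forall>z. \<bar>z - \<theta>\<bar> < \<epsilon> \<longrightarrow> z < a" by (auto simp: \<epsilon>_def)
        then show ?thesis using assms by blast
      next
        case 3
        then have "\<forall>z. \<bar>z - \<theta>\<bar> < \<epsilon> \<longrightarrow> a < z \<and> z < b" by (auto simp: \<epsilon>_def)
        then show ?thesis using assms by blast
      qed
    qed
    ultimately show False by metis
  qed
qed


section \<open>The network, its flow and its cut\<close>

text \<open>
  Source \<open>0\<close>, sink \<open>4k + 3\<close>; \<open>u\<^sub>i\<close> is vertex \<open>2i + 2\<close>, and vertex \<open>2i + 3\<close> subdivides the fast route
  from \<open>u\<^sub>i\<close> to \<open>u\<^sub>i\<^sub>+\<^sub>1\<close>, since parallel edges are not available.
\<close>

definition chain_shift :: "nat \<Rightarrow> nat \<Rightarrow> real" where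
  "chain_shift k i = (if i < k then 2 ^ (i + 1) else 2 ^ (2 * k - i))"

definition chain_edges :: "nat \<Rightarrow> edge set" where
  "chain_edges k = (\<Union>i<2 * k. {(2 * i + 2, 2 * i + 3), (2 * i + 3, 2 * i + 4), (2 * i + 2, 2 * i + 4)})"

definition flow_edges :: "nat \<Rightarrow> edge set" where
  "flow_edges k = {(0, 1), (0, 2), (1, 2), (1, 4 * k + 2), (2, 4 * k + 3), (4 * k + 2, 4 * k + 3)}"

text \<open>One family serves both variants: \<open>b\<close> and \<open>u\<close> are the transit
  time and the capacity of \<open>(0, 1)\<close> after the jump. The test
  \<open>snd e = fst e + 2\<close> singles out the slow routes of the chain, since
  \<open>(0, 2)\<close> is matched earlier.\<close>

definition chain_network :: "nat \<Rightarrow> real \<Rightarrow> real \<Rightarrow> network" where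
  "chain_network k b u =
    \<lparr>verts = {..<4 * k + 4}, edges = flow_edges k \<union> chain_edges k,
     src = 0, snk = 4 * k + 3, horizon = 4 * 2 ^ k - 3 / 2,
     transit = (\<lambda>e \<Theta>.
       if e = (0, 1) then if \<Theta> < 2 * 2 ^ k then 0 else b
       else if e = (0, 2) then 2 * 2 ^ k - 1
       else if e = (1, 4 * k + 2) then 2 * 2 ^ k - 2
       else if snd e = fst e + 2 then chain_shift k (fst e div 2 - 1)
       else 0),
     cap = (\<lambda>e \<Theta>. if e = (0, 1) then if \<Theta> < 2 * 2 ^ k then 2 else u else 1)\<rparr>"

text \<open>Two units pass through vertex \<open>1\<close> until the jump, one on to each of the
  vertices \<open>2\<close> and \<open>4 * k + 2\<close>; then \<open>(0, 2)\<close> takes over the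
  supply of vertex \<open>2\<close>. Conservation is required at every single time, so the ends are
  open or closed in such a way that the two supplies abut exactly.\<close>

definition active_interval :: "nat \<Rightarrow> edge \<Rightarrow> real set" where
  "active_interval k e =
    (if e \<in> {(0, 1), (1, 2), (1, 4 * k + 2)} then {0..<2 * 2 ^ k}
     else if e = (0, 2) then {1..2 * 2 ^ k - 1 / 2}
     else if e = (2, 4 * k + 3) then {0..4 * 2 ^ k - 3 / 2}
     else if e = (4 * k + 2, 4 * k + 3) then {2 * 2 ^ k - 2..<4 * 2 ^ k - 2}
     else {})"

definition chain_flow :: "nat \<Rightarrow> edge \<Rightarrow> real \<Rightarrow> real" where
  "chain_flow k e \<Theta> = (if e = (0, 1) then 2 else 1) * indicator (active_interval k e) \<Theta>"

text \<open>The times obtained for \<open>u\<^sub>i\<close> by closing the window of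
  \<open>u\<^sub>0\<close> under the fast and the slow routes.\<close>

primrec reached :: "nat \<Rightarrow> nat \<Rightarrow> real \<Rightarrow> bool" where
  "reached k 0 \<Theta> = (\<Theta> \<in> {2 * 2 ^ k - 1..<2 * 2 ^ k})"
| "reached k (Suc i) \<Theta> = (reached k i \<Theta> \<or> reached k i (\<Theta> - chain_shift k i))"

text \<open>Rounding in \<open>v div 2\<close> gives a subdividing vertex the state of the
  \<open>u\<^sub>i\<close> before it. The last chain vertex \<open>4 * k + 2\<close> is on the
  source side exactly while its edge to the sink carries flow, or after the horizon; this covers
  every time that \<open>reached\<close> would give it.\<close>

definition chain_cut :: "nat \<Rightarrow> nat \<Rightarrow> real \<Rightarrow> bool" where
  "chain_cut k v \<Theta> = (\<Theta> > 4 * 2 ^ k - 3 / 2 \<or>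
    (if v = 0 then True
     else if v = 1 then \<Theta> < 2 * 2 ^ k
     else if v = 4 * k + 2 then \<Theta> \<in> {2 * 2 ^ k - 2..<4 * 2 ^ k - 2}
     else if v = 4 * k + 3 then False
     else reached k (v div 2 - 1) \<Theta>))"

section \<open>Times reached along the chain\<close>

lemma chain_shift_even: "i < 2 * k \<Longrightarrow> \<exists>n::nat. chain_shift k i = 2 * real n"
proof -
  assume "i < 2 * k"
  then have "chain_shift k i = 2 * real (2 ^ (if i < k then i else 2 * k - i - 1))"
    by (auto simp: chain_shift_def power_Suc[symmetric] Suc_diff_Suc simp del: power_Suc)
  then show ?thesis by blast
qed

lemma chain_shift_nonneg: "0 \<le> chain_shift k i"
  by (simp add: chain_shift_def)

text \<open>The slow transit times are even and the fast ones zero, so the window moves only by even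
  amounts.\<close>

lemma reached_window:
  "i \<le> 2 * k \<Longrightarrow> reached k i \<Theta> \<Longrightarrow> \<exists>n::nat. \<Theta> - 2 * real n \<in> {2 * 2 ^ k - 1..<2 * 2 ^ k}"
proof (induction i arbitrary: \<Theta>)
  case 0
  then show ?case by (intro exI[of _ 0]) simp
next
  case (Suc i)
  obtain m :: nat where m: "chain_shift k i = 2 * real m"
    using chain_shift_even[of i k] Suc.prems by auto
  from Suc.prems(2) have "reached k i \<Theta> \<or> reached k i (\<Theta> - 2 * real m)"
    by (simp add: m)
  then show ?case
  proof
    assume "reached k i (\<Theta> - 2 * real m)"
    then obtain n :: nat where "\<Theta> - 2 * real m - 2 * real n \<in> {2 * 2 ^ k - 1..<2 * 2 ^ k}"
      using Suc by (meson Suc_leD)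
    then show ?thesis by (intro exI[of _ "m + n"]) (simp add: algebra_simps)
  qed (use Suc in simp)
qed

text \<open>A translate of the window by \<open>2 * n\<close> that starts within the horizon has
  \<open>n \<le> 2 ^ k - 1\<close> by integrality, and therefore ends by
  \<open>4 * 2 ^ k - 2\<close>, half a time unit before the horizon.\<close>

lemma reached_before_end:
  assumes "i \<le> 2 * k" "reached k i \<Theta>" "\<Theta> \<le> 4 * 2 ^ k - 3 / 2"
  shows "\<Theta> \<in> {2 * 2 ^ k - 2..<4 * 2 ^ k - 2}"
proof -
  obtain n :: nat where n: "\<Theta> - 2 * real n \<in> {2 * 2 ^ k - 1..<2 * 2 ^ k}"
    using reached_window[OF assms(1,2)] by blast
  have "2 * real n < 2 * 2 ^ k" using n assms(3) unfolding atLeastLessThan_iff by linarith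
  then have "real n < 2 ^ k" by linarith
  then have "n + 1 \<le> 2 ^ k"
    by (metis Suc_eq_plus1 Suc_leI of_nat_less_numeral_power_cancel_iff)
  then have "real n + 1 \<le> 2 ^ k"
    by (metis of_nat_1 of_nat_add of_nat_le_numeral_power_cancel_iff)
  with n show ?thesis by auto
qed

lemma reached_borel: "{\<Theta>. reached k i \<Theta>} \<in> sets borel"
proof (induction i)
  case (Suc i)
  have "(\<lambda>\<Theta>. \<Theta> - chain_shift k i) -` {\<Theta>. reached k i \<Theta>} \<inter> space borel \<in> sets borel"
    by (rule measurable_sets[OF _ Suc]) simp
  then have "{\<Theta>. reached k i \<Theta>} \<union> (\<lambda>\<Theta>. \<Theta> - chain_shift k i) -` {\<Theta>. reached k i \<Theta>} \<in> sets borel"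
    using Suc by auto
  also have "{\<Theta>. reached k i \<Theta>} \<union> (\<lambda>\<Theta>. \<Theta> - chain_shift k i) -` {\<Theta>. reached k i \<Theta>} = {\<Theta>. reached k (Suc i) \<Theta>}"
    by auto
  finally show ?case .
qed (auto simp: atLeastLessThan_def[symmetric])

lemma chain_edges_cases:
  assumes "e \<in> chain_edges k"
  obtains i where "i < 2 * k" "e = (2 * i + 2, 2 * i + 3)"
  | i where "i < 2 * k" "e = (2 * i + 3, 2 * i + 4)"
  | i where "i < 2 * k" "e = (2 * i + 2, 2 * i + 4)"
  using assms by (auto simp: chain_edges_def)

lemma chain_flow_chain: "e \<in> chain_edges k \<Longrightarrow> chain_flow k e = (\<lambda>_. 0)"
  unfolding chain_flow_def active_interval_def chain_edges_def by (rule ext) (auto, presburger)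

section \<open>The network as an instance of the duality theory\<close>

text \<open>\<open>blocked\<close> is what the optimality proof needs to know about the jump: from
  then on \<open>(0, 1)\<close> has no capacity, or what enters it arrives after the
  horizon.\<close>

locale chain_net =
  fixes k :: nat and b u :: real
  assumes k: "k \<ge> 1" and b: "b \<ge> 0" and u: "u \<ge> 0"
    and blocked: "u = 0 \<or> b > 4 * 2 ^ k - 3 / 2"
begin

abbreviation "N \<equiv> chain_network k b u"

lemma K: "(2::real) ^ k \<ge> 2"
  using k power_increasing[of 1 k "2::real"] by simp

lemma net_simps [simp]:
  "verts N = {..<4 * k + 4}" "edges N = flow_edges k \<union> chain_edges k" "src N = 0" "snk N = 4 * k + 3"
  "horizon N = 4 * 2 ^ k - 3 / 2"
  by (simp_all add: chain_network_def)

lemma cap_simps [simp]: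
  "cap N (0, Suc 0) \<Theta> = (if \<Theta> < 2 * 2 ^ k then 2 else u)"
  "e \<noteq> (0, Suc 0) \<Longrightarrow> cap N e \<Theta> = 1"
  by (simp_all add: chain_network_def)

lemma transit_eqs:
  "transit N (0, Suc 0) \<Theta> = (if \<Theta> < 2 * 2 ^ k then 0 else b)"
  "transit N (0, 2) \<Theta> = 2 * 2 ^ k - 1"
  "transit N (Suc 0, 2) \<Theta> = 0"
  "transit N (Suc 0, 4 * k + 2) \<Theta> = 2 * 2 ^ k - 2"
  "transit N (2, 4 * k + 3) \<Theta> = 0"
  "transit N (4 * k + 2, 4 * k + 3) \<Theta> = 0"
  "transit N (2 * i + 2, 2 * i + 3) \<Theta> = 0"
  "transit N (2 * i + 3, 2 * i + 4) \<Theta> = 0"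
  "transit N (2 * i + 2, 2 * i + 4) \<Theta> = chain_shift k i"
  using k by (simp_all add: chain_network_def)

lemmas transit_simps [simp] = transit_eqs[simplified]

lemma transit_const: "e \<in> edges N \<Longrightarrow> e \<noteq> (0, 1) \<Longrightarrow> \<exists>c. \<forall>\<Theta>. transit N e \<Theta> = c"
  by (auto simp: chain_network_def)

lemma wf: "wf_network N"
proof -
  have disc: "finite {\<Theta> \<in> {0..horizon N}. \<not> continuous (at \<Theta> within {0..horizon N}) (cap N e)}" for e
  proof (cases "e = (0, 1)")
    case True
    have "continuous (at \<Theta> within {0..horizon N}) (cap N e)" if "\<Theta> \<noteq> 2 * 2 ^ k" for \<Theta>
    proof -
      have "isCont (cap N e) \<Theta>"
      proof (cases "\<Theta> < 2 * 2 ^ k")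
        case lt: True
        then have "eventually (\<lambda>x. x \<in> {..<2 * 2 ^ k}) (nhds \<Theta>)"
          by (intro eventually_nhds_in_open) auto
        then have "eventually (\<lambda>x. cap N e x = 2) (nhds \<Theta>)"
          by eventually_elim (use True in simp)
        then show ?thesis by (subst isCont_cong) auto
      next
        case False
        then have "eventually (\<lambda>x. x \<in> {2 * 2 ^ k<..}) (nhds \<Theta>)"
          using that by (intro eventually_nhds_in_open) auto
        then have "eventually (\<lambda>x. cap N e x = u) (nhds \<Theta>)"
          by eventually_elim (use True in simp)
        then show ?thesis by (subst isCont_cong) auto
      qed
      then show ?thesis by (rule continuous_at_imp_continuous_at_within)
    qed
    then have "{\<Theta> \<in> {0..horizon N}. \<not> continuous (at \<Theta> within {0..horizon N}) (cap N e)} \<subseteq> {2 * 2 ^ k}"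
      by blast
    then show ?thesis by (rule finite_subset) simp
  next
    case False
    then have "cap N e = (\<lambda>_. 1)" by (intro ext) simp
    then show ?thesis by simp
  qed
  have sub: "edges N \<subseteq> verts N \<times> verts N"
    by (auto simp: flow_edges_def chain_edges_def)
  have tr: "0 \<le> transit N e \<Theta>" for e \<Theta>
    using K b by (auto simp: chain_network_def chain_shift_nonneg)
  have cp: "0 \<le> cap N e \<Theta>" for e \<Theta>
    using u by (cases "e = (0, 1)") auto
  show ?thesis
    unfolding wf_network_def using disc sub tr cp K by auto
qed

sublocale jump_network N
proof
  show "wf_network N" by (rule wf)
  show "\<exists>a b \<theta>0. \<forall>\<Theta>. transit N e \<Theta> = (if \<Theta> < \<theta>0 then a else b)" if "e \<in> edges N" for e
  proof (cases "e = (0, 1)")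
    case True
    then show ?thesis
      by (intro exI[of _ 0] exI[of _ b] exI[of _ "2 * 2 ^ k"]) simp
  next
    case False
    then show ?thesis using transit_const[OF that] by auto
  qed
  show "set_integrable lebesgue {0..horizon N} (cap N e)" if "e \<in> edges N" for e
  proof -
    have "cap N e \<in> borel_measurable borel"
      by (cases "e = (0, 1)") (simp_all add: chain_network_def)
    then have m: "cap N e \<in> borel_measurable lebesgue"
      by (simp add: measurable_completion)
    \<comment> \<open>\<open>2 + u\<close> dominates both values of the jumping capacity as well as
      the constant capacity \<open>1\<close>.\<close>
    have "integrable lebesgue (\<lambda>x. (2 + u) * indicat_real {0..horizon N} x)"
      by (intro integrable_mult_right integrable_real_indicator) (auto simp: emeasure_lborel_Icc_eq)
    then show ?thesis
      unfolding set_integrable_def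
    proof (rule Bochner_Integration.integrable_bound)
      show "(\<lambda>x. indicat_real {0..horizon N} x *\<^sub>R cap N e x) \<in> borel_measurable lebesgue"
        using m by (intro borel_measurable_scaleR borel_measurable_indicator) auto
      show "AE x in lebesgue. norm (indicat_real {0..horizon N} x *\<^sub>R cap N e x)
          \<le> norm ((2 + u) * indicat_real {0..horizon N} x)"
        using u by (cases "e = (0, 1)") (auto simp: indicator_def)
    qed
  qed
qed

section \<open>Feasibility of the flow\<close>

lemma flow_supported:
  "chain_flow k e \<Theta> \<noteq> 0 \<Longrightarrow> e \<in> flow_edges k \<and> 0 \<le> \<Theta> \<and> \<Theta> + transit N e \<Theta> \<le> horizon N"
  using K by (auto simp: chain_flow_def active_interval_def flow_edges_def indicator_def split: if_splits)

lemma inflow_eq: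
  "inflow N (chain_flow k) v \<theta> = (\<Sum>e\<in>{e \<in> flow_edges k. snd e = v}. arrivals N (chain_flow k) e \<theta>)"
  unfolding inflow_def using finite_edges
  by (intro sum.mono_neutral_right) (auto simp: arrivals_def chain_flow_chain)

lemma outflow_eq:
  "outflow N (chain_flow k) v \<theta> = (\<Sum>e\<in>{e \<in> flow_edges k. fst e = v}. chain_flow k e \<theta>)"
  unfolding outflow_def using finite_edges
  by (intro sum.mono_neutral_right) (auto simp: chain_flow_chain)

lemma chain_flow_eqs [simplified]:
  "chain_flow k (0, Suc 0) \<Theta> = (if 0 \<le> \<Theta> \<and> \<Theta> < 2 * 2 ^ k then 2 else 0)"
  "chain_flow k (0, 2) \<Theta> = (if 1 \<le> \<Theta> \<and> \<Theta> \<le> 2 * 2 ^ k - 1 / 2 then 1 else 0)"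
  "chain_flow k (Suc 0, 2) \<Theta> = (if 0 \<le> \<Theta> \<and> \<Theta> < 2 * 2 ^ k then 1 else 0)"
  "chain_flow k (Suc 0, 4 * k + 2) \<Theta> = (if 0 \<le> \<Theta> \<and> \<Theta> < 2 * 2 ^ k then 1 else 0)"
  "chain_flow k (2, 4 * k + 3) \<Theta> = (if 0 \<le> \<Theta> \<and> \<Theta> \<le> 4 * 2 ^ k - 3 / 2 then 1 else 0)"
  "chain_flow k (4 * k + 2, 4 * k + 3) \<Theta> =
     (if 2 * 2 ^ k - 2 \<le> \<Theta> \<and> \<Theta> < 4 * 2 ^ k - 2 then 1 else 0)"
  using k by (simp_all add: chain_flow_def active_interval_def)

lemma flow_conservation:
  assumes "v \<in> verts N - {src N, snk N}"
  shows "inflow N (chain_flow k) v \<theta> = outflow N (chain_flow k) v \<theta>"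
proof -
  have arr: "arrivals N (chain_flow k) (0, Suc 0) \<theta> = chain_flow k (0, Suc 0) \<theta>"
    "arrivals N (chain_flow k) (0, 2) \<theta> = chain_flow k (0, 2) (\<theta> - (2 * 2 ^ k - 1))"
    "arrivals N (chain_flow k) (Suc 0, 2) \<theta> = chain_flow k (Suc 0, 2) \<theta>"
    "arrivals N (chain_flow k) (Suc 0, 4 * k + 2) \<theta> = chain_flow k (Suc 0, 4 * k + 2) (\<theta> - (2 * 2 ^ k - 2))"
    using arrivals_jump[of N "(0, Suc 0)" "2 * 2 ^ k" 0 b "chain_flow k" \<theta>]
    by (auto simp: arrivals_const chain_flow_def active_interval_def indicator_def)
  consider "v = 1" | "v = 2" | "v = 4 * k + 2" | "v \<notin> {0, 1, 2, 4 * k + 2, 4 * k + 3}"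
    using assms by auto
  then show ?thesis
  proof cases
    case 1
    then have "{e \<in> flow_edges k. snd e = v} = {(0, 1)}" "{e \<in> flow_edges k. fst e = v} = {(1, 2), (1, 4 * k + 2)}"
      using k by (auto simp: flow_edges_def)
    then show ?thesis using k
      by (simp add: inflow_eq outflow_eq arr chain_flow_eqs)
  next
    case 2
    then have "{e \<in> flow_edges k. snd e = v} = {(0, 2), (1, 2)}" "{e \<in> flow_edges k. fst e = v} = {(2, 4 * k + 3)}"
      using k by (auto simp: flow_edges_def)
    then show ?thesis using K
      by (auto simp: inflow_eq outflow_eq arr chain_flow_eqs)
  next
    case 3
    then have "{e \<in> flow_edges k. snd e = v} = {(1, 4 * k + 2)}" "{e \<in> flow_edges k. fst e = v} = {(4 * k + 2, 4 * k + 3)}"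
      using k by (auto simp: flow_edges_def)
    then show ?thesis using K k arr(4)
      by (auto simp: inflow_eq outflow_eq chain_flow_eqs)
  next
    case 4
    then have "{e \<in> flow_edges k. snd e = v} = {}" "{e \<in> flow_edges k. fst e = v} = {}"
      by (auto simp: flow_edges_def)
    then show ?thesis unfolding inflow_eq outflow_eq by (simp only: sum.empty)
  qed
qed

lemma flow: "dynamic_flow N (chain_flow k)"
proof -
  have "chain_flow k e \<in> borel_measurable lebesgue" for e
  proof -
    have "active_interval k e \<in> sets lebesgue"
      by (auto simp: active_interval_def)
    then have "(\<lambda>\<Theta>. (if e = (0, 1) then 2 else 1) * indicat_real (active_interval k e) \<Theta>) \<in> borel_measurable lebesgue"
      by (intro borel_measurable_times borel_measurable_indicator) auto
    moreover have "chain_flow k e = (\<lambda>\<Theta>. (if e = (0, 1) then 2 else 1) * indicat_real (active_interval k e) \<Theta>)"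
      by (rule ext) (simp only: chain_flow_def)
    ultimately show ?thesis by (simp only:)
  qed
  moreover have "0 \<le> chain_flow k e \<Theta>" for e \<Theta>
    by (simp add: chain_flow_def)
  moreover have "chain_flow k e \<Theta> \<le> cap N e \<Theta>" for e \<Theta>
    using u by (cases "e = (0, 1)") (auto simp: chain_flow_def active_interval_def indicator_def)
  moreover have "chain_flow k e \<Theta> = 0" if "\<Theta> < 0" for e \<Theta>
    using flow_supported[of e \<Theta>] that by fastforce
  moreover have "chain_flow k e \<Theta> = 0" if "\<Theta> + transit N e \<Theta> > horizon N" for e \<Theta>
    using flow_supported[of e \<Theta>] that by fastforce
  ultimately show ?thesis
    unfolding dynamic_flow_def using flow_conservation by auto
qed

section \<open>Optimality of the flow and the cut\<close>

lemma cut: "dynamic_cut N (chain_cut k)"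
proof -
  have "{\<Theta>. chain_cut k v \<Theta>} \<in> sets borel" for v
  proof -
    have "{\<Theta>. chain_cut k v \<Theta>} = {4 * 2 ^ k - 3 / 2<..} \<union>
      (if v = 0 then UNIV else if v = 1 then {..<2 * 2 ^ k}
       else if v = 4 * k + 2 then {2 * 2 ^ k - 2..<4 * 2 ^ k - 2}
       else if v = 4 * k + 3 then {} else {\<Theta>. reached k (v div 2 - 1) \<Theta>})"
      by (auto simp: chain_cut_def)
    then show ?thesis using reached_borel by auto
  qed
  then have "{\<Theta>. chain_cut k v \<Theta>} \<in> sets lebesgue" for v
    by auto
  moreover have "chain_cut k (src N) \<Theta>" "\<Theta> \<le> horizon N \<Longrightarrow> \<not> chain_cut k (snk N) \<Theta>"
    "\<Theta> > horizon N \<Longrightarrow> chain_cut k v \<Theta>" for v \<Theta>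
    by (simp_all add: chain_cut_def)
  ultimately show ?thesis
    unfolding dynamic_cut_def by (metis atLeastAtMost_iff)
qed

text \<open>\<open>reached\<close> is closed under both routes by construction,
  \<open>reached_before_end\<close> takes care of the last chain vertex, and after the horizon every
  vertex is on the source side.\<close>

lemma chain_edge_uncut:
  assumes "e \<in> chain_edges k" "chain_cut k (fst e) \<Theta>"
  shows "chain_cut k (snd e) (\<Theta> + transit N e \<Theta>)"
proof (rule ccontr)
  assume neg: "\<not> ?thesis"
  have "transit N e \<Theta> \<ge> 0" using assms(1) transit_nonneg by simp
  then have le: "\<Theta> + transit N e \<Theta> \<le> 4 * 2 ^ k - 3 / 2" "\<Theta> \<le> 4 * 2 ^ k - 3 / 2"
    using neg by (auto simp: chain_cut_def)
  have uncut: False if "i \<le> 2 * k" "reached k i (\<Theta> + transit N e \<Theta>)" "snd e = 2 * i + 2 \<or> snd e = 2 * i + 3 \<and> i < 2 * k" for i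
    using neg that reached_before_end[OF that(1,2) le(1)]
    by (auto simp: chain_cut_def split: if_splits)
  from assms(1) show False
  proof (cases rule: chain_edges_cases)
    case (1 i)
    then have "reached k i \<Theta>" using assms(2) le by (auto simp: chain_cut_def)
    then show False using uncut[of i] 1 by simp
  next
    case (2 i)
    \<comment> \<open>Subdividing vertices are odd and, as \<open>i < 2 * k\<close>, distinct from
      the sink, so \<open>chain_cut\<close> treats them by \<open>reached\<close>.\<close>
    then have "2 * i + 3 \<noteq> 4 * k + 2" "2 * i + 3 \<noteq> 4 * k + 3" by presburger+
    then have "reached k i \<Theta>" using assms(2) le 2 by (auto simp: chain_cut_def)
    then show False using uncut[of "Suc i"] 2 transit_eqs(8)[of i \<Theta>] by simp
  next
    case (3 i)
    then have "reached k i \<Theta>" using assms(2) le by (auto simp: chain_cut_def)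
    then show False using uncut[of "Suc i"] 3 transit_eqs(9)[of i \<Theta>] by simp
  qed
qed

lemma chain_cut_eqs [simplified]:
  "chain_cut k 0 \<Theta>"
  "chain_cut k (Suc 0) \<Theta> \<longleftrightarrow> \<Theta> > 4 * 2 ^ k - 3 / 2 \<or> \<Theta> < 2 * 2 ^ k"
  "chain_cut k 2 \<Theta> \<longleftrightarrow> \<Theta> > 4 * 2 ^ k - 3 / 2 \<or> \<Theta> \<in> {2 * 2 ^ k - 1..<2 * 2 ^ k}"
  "chain_cut k (4 * k + 2) \<Theta> \<longleftrightarrow> \<Theta> > 4 * 2 ^ k - 3 / 2 \<or> \<Theta> \<in> {2 * 2 ^ k - 2..<4 * 2 ^ k - 2}"
  "chain_cut k (4 * k + 3) \<Theta> \<longleftrightarrow> \<Theta> > 4 * 2 ^ k - 3 / 2"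
  using k by (simp_all add: chain_cut_def)

text \<open>Chain edges are empty and never cut. The edge \<open>(0, 1)\<close> is cut, if at all,
  only with capacity \<open>0\<close>; \<open>(0, 2)\<close> has spare capacity only when flow
  entering it would arrive while vertex \<open>2\<close> is on the source side or after the horizon;
  the remaining edges are saturated while their tail is on the source side within the horizon. No
  flow returns to the source side.\<close>

lemma no_gap:
  assumes "e \<in> edges N"
  shows "duality_gap N (chain_cut k) (chain_flow k) e \<Theta> = 0"
proof (cases "e \<in> chain_edges k")
  case True
  then show ?thesis
    using chain_edge_uncut[OF True, of \<Theta>] by (auto simp: duality_gap_def chain_flow_chain)
next
  case False
  then have "e \<in> flow_edges k" using assms by simp
  then consider "e = (0, 1)" | "e = (0, 2)" | "e = (1, 2)" | "e = (1, 4 * k + 2)"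
    | "e = (2, 4 * k + 3)" | "e = (4 * k + 2, 4 * k + 3)"
    unfolding flow_edges_def by blast
  then show ?thesis
  proof cases
    case 1
    then show ?thesis using blocked
      by (auto simp: duality_gap_def chain_cut_eqs chain_flow_eqs)
  next
    case 2
    then show ?thesis using K
      by (auto simp: duality_gap_def chain_cut_eqs chain_flow_eqs)
  next
    case 3
    then show ?thesis
      by (auto simp: duality_gap_def chain_cut_eqs chain_flow_eqs)
  next
    case 4
    then show ?thesis
      by (auto simp: duality_gap_def chain_cut_eqs chain_flow_eqs)
  next
    case 5
    then show ?thesis
      by (auto simp: duality_gap_def chain_cut_eqs chain_flow_eqs)
  next
    case 6
    then show ?thesis
      by (auto simp: duality_gap_def chain_cut_eqs chain_flow_eqs)
  qed
qed

lemma max_flow: "max_flow N (chain_flow k)"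
  unfolding max_flow_def using flow weak_duality[OF _ cut] optimal_if_no_gap[OF flow cut no_gap] by simp

lemma min_cut: "min_cut N (chain_cut k)"
  unfolding min_cut_def using cut weak_duality[OF flow] optimal_if_no_gap[OF flow cut no_gap] by simp

section \<open>Forced sides in an arbitrary minimum cut\<close>

context
  fixes S assumes S: "min_cut N S"
begin

lemma S_cut: "dynamic_cut N S"
  using S by (simp add: min_cut_def)

lemma S_no_gap: "e \<in> edges N \<Longrightarrow> AE \<Theta> in lebesgue. duality_gap N S (chain_flow k) e \<Theta> = 0"
  using S cut optimal_if_no_gap[OF flow cut no_gap]
  by (intro complementary_slackness[OF flow]) (auto simp: min_cut_def)

text \<open>A chain edge has capacity \<open>1\<close> and carries no flow, so cutting it would
  produce a gap of \<open>1\<close>.\<close>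

lemma chain_edge_closed:
  assumes e: "e \<in> chain_edges k"
  shows "AE \<Theta> in lebesgue. \<Theta> \<in> {0..horizon N} \<longrightarrow> S (fst e) \<Theta> \<longrightarrow> S (snd e) (\<Theta> + transit N e \<Theta>)"
proof -
  have ne: "e \<noteq> (0, Suc 0)" using e by (auto simp: chain_edges_def)
  have "AE \<Theta> in lebesgue. duality_gap N S (chain_flow k) e \<Theta> = 0"
    using e by (intro S_no_gap) simp
  then show ?thesis
    by eventually_elim (auto simp: duality_gap_def chain_flow_chain[OF e] ne split: if_splits)
qed

lemma chain_step:
  assumes i: "i < 2 * k"
  shows "AE \<Theta> in lebesgue. \<Theta> \<in> {0..horizon N} \<longrightarrow> S (2 * i + 2) \<Theta> \<longrightarrow>
    S (2 * i + 4) \<Theta> \<and> S (2 * i + 4) (\<Theta> + chain_shift k i)"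
proof -
  have "(2 * i + 2, 2 * i + 3) \<in> chain_edges k" "(2 * i + 3, 2 * i + 4) \<in> chain_edges k"
    "(2 * i + 2, 2 * i + 4) \<in> chain_edges k"
    using i by (auto simp: chain_edges_def)
  note this[THEN chain_edge_closed, unfolded transit_eqs fst_conv snd_conv]
  then show ?thesis
    by eventually_elim simp
qed

text \<open>The edge \<open>(0, 2)\<close> is idle during the first time unit although its tail is
  the source, so vertex \<open>2\<close> must be on the source side one transit time later.\<close>

lemma start_forced: "AE \<Theta> in lebesgue. \<Theta> \<in> {2 * 2 ^ k - 1<..<2 * 2 ^ k} \<longrightarrow> S 2 \<Theta>"
proof -
  have "AE \<Theta> in lebesgue. duality_gap N S (chain_flow k) (0, 2) \<Theta> = 0"
    by (intro S_no_gap) (simp add: flow_edges_def)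
  then have "AE \<Theta> in lebesgue. \<Theta> \<in> {0<..<1} \<longrightarrow> S 2 (\<Theta> + (2 * 2 ^ k - 1))"
  proof eventually_elim
    case (elim \<Theta>)
    show ?case
    proof
      assume *: "\<Theta> \<in> {0<..<1}"
      then have "S 0 \<Theta>" using S_cut K by (auto simp: dynamic_cut_def)
      with elim * K show "S 2 (\<Theta> + (2 * 2 ^ k - 1))"
        by (auto simp: duality_gap_def chain_flow_def active_interval_def split: if_splits)
    qed
  qed
  from AE_lebesgue_translate[OF this, of "- (2 * 2 ^ k - 1)"] show ?thesis
    by eventually_elim auto
qed

text \<open>The edge into the sink is idle after time \<open>4 * 2 ^ k - 2\<close>, so its tail must
  be on the sink side until the horizon.\<close>

lemma end_forced: "AE \<Theta> in lebesgue. \<Theta> \<in> {4 * 2 ^ k - 2<..<4 * 2 ^ k - 3 / 2} \<longrightarrow> \<not> S (4 * k + 2) \<Theta>"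
proof -
  have "AE \<Theta> in lebesgue. duality_gap N S (chain_flow k) (4 * k + 2, 4 * k + 3) \<Theta> = 0"
    by (intro S_no_gap) (simp add: flow_edges_def)
  then show ?thesis
  proof eventually_elim
    case (elim \<Theta>)
    show ?case
    proof
      assume *: "\<Theta> \<in> {4 * 2 ^ k - 2<..<4 * 2 ^ k - 3 / 2}"
      then have "\<not> S (4 * k + 3) \<Theta>" using S_cut K by (auto simp: dynamic_cut_def)
      with elim * K k show "\<not> S (4 * k + 2) \<Theta>"
        by (auto simp: duality_gap_def chain_flow_def active_interval_def split: if_splits)
    qed
  qed
qed

text \<open>The binary digits of \<open>m\<close> select a path: the slow route at digit 1, the fast
  one at digit 0.\<close>

lemma forward_forced:
  "i \<le> k \<Longrightarrow> m < 2 ^ i \<Longrightarrow>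
    AE \<Theta> in lebesgue. \<Theta> \<in> {2 * 2 ^ k - 1<..<2 * 2 ^ k} \<longrightarrow> S (2 * i + 2) (\<Theta> + 2 * real m)"
proof (induction i arbitrary: m)
  case 0
  then show ?case using start_forced by (simp add: numeral_2_eq_2)
next
  case (Suc i)
  have sh: "chain_shift k i = 2 * 2 ^ i" using Suc.prems by (simp add: chain_shift_def)
  \<comment> \<open>\<open>m\<close> without its digit of weight \<open>2 ^ i\<close>, which the
    route from \<open>u\<^sub>i\<close> contributes.\<close>
  define m' where "m' = (if m < 2 ^ i then m else m - 2 ^ i)"
  have m': "m' < 2 ^ i" using Suc.prems by (auto simp: m'_def)
  \<comment> \<open>\<open>chain_step\<close> needs the departure time within the horizon: it is
    below \<open>3 * 2 ^ k\<close>, which suffices because \<open>2 ^ k \<ge> 2\<close>.\<close>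
  have "real m' < 2 ^ i" using m' by simp
  also have "(2::real) ^ i \<le> 2 ^ (k - 1)" using Suc.prems by (intro power_increasing) auto
  also have "2 * (2::real) ^ (k - 1) = 2 ^ k" using k by (simp add: power_eq_if)
  finally have small: "2 * real m' < 2 ^ k" by simp
  have "AE \<Theta> in lebesgue. \<Theta> \<in> {2 * 2 ^ k - 1<..<2 * 2 ^ k} \<longrightarrow> S (2 * i + 2) (\<Theta> + 2 * real m')"
    using Suc.IH[OF _ m'] Suc.prems by simp
  moreover have "AE \<Theta> in lebesgue. \<Theta> + 2 * real m' \<in> {0..horizon N} \<longrightarrow> S (2 * i + 2) (\<Theta> + 2 * real m') \<longrightarrow>
    S (2 * i + 4) (\<Theta> + 2 * real m') \<and> S (2 * i + 4) (\<Theta> + 2 * real m' + chain_shift k i)"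
    using Suc.prems by (intro AE_lebesgue_translate chain_step) auto
  ultimately show ?case
  proof eventually_elim
    case (elim \<Theta>)
    show ?case
    proof
      assume *: "\<Theta> \<in> {2 * 2 ^ k - 1<..<2 * 2 ^ k}"
      then have "\<Theta> + 2 * real m' \<in> {0..horizon N}" using small K by auto
      with elim * have S: "S (2 * i + 4) (\<Theta> + 2 * real m')"
        "S (2 * i + 4) (\<Theta> + (2 * real m' + chain_shift k i))"
        by (auto simp: add.assoc)
      have idx: "2 * Suc i + 2 = 2 * i + 4" by simp
      have "S (2 * i + 4) (\<Theta> + 2 * real m)"
      proof (cases "m < 2 ^ i")
        case True
        then show ?thesis using S by (simp add: m'_def)
      next
        case False
        then have "2 * real m' + chain_shift k i = 2 * real m"
          by (simp add: m'_def sh of_nat_diff)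
        then show ?thesis using S(2) by simp
      qed
      then show "S (2 * Suc i + 2) (\<Theta> + 2 * real m)" unfolding idx .
    qed
  qed
qed

text \<open>The contrapositive of \<open>chain_step\<close>, run from the end of the chain. Thanks
  to the mirrored order of the shifts, the digits of \<open>m\<close> are used as in
  \<open>forward_forced\<close>: a vertex on the source side would put its successor there at a
  forbidden time.\<close>

lemma backward_forced:
  "i \<le> k \<Longrightarrow> m < 2 ^ i \<Longrightarrow>
    AE \<Theta> in lebesgue. \<Theta> \<in> {4 * 2 ^ k - 2<..<4 * 2 ^ k - 3 / 2} \<longrightarrow> \<not> S (2 * (2 * k - i) + 2) (\<Theta> - 2 * real m)"
proof (induction i arbitrary: m)
  case 0
  then show ?case using end_forced by simp
next
  case (Suc i)
  define l where "l = 2 * k - Suc i"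
  have l: "l < 2 * k" "2 * (2 * k - i) + 2 = 2 * l + 4" using Suc.prems by (auto simp: l_def)
  have sh: "chain_shift k l = 2 * 2 ^ i"
    using Suc.prems by (auto simp: chain_shift_def l_def)
  define m' where "m' = (if m < 2 ^ i then m else m - 2 ^ i)"
  have m': "m' < 2 ^ i" using Suc.prems by (auto simp: m'_def)
  \<comment> \<open>The departure now takes place at \<open>\<Theta> - 2 * m\<close>, so
    \<open>m\<close> itself must be bounded to keep it nonnegative.\<close>
  have "real m < 2 ^ Suc i" using Suc.prems(2) by (metis of_nat_less_numeral_power_cancel_iff)
  also have "(2::real) ^ Suc i \<le> 2 ^ k" using Suc.prems by (intro power_increasing) auto
  finally have small: "real m < 2 ^ k" .
  have "AE \<Theta> in lebesgue. \<Theta> \<in> {4 * 2 ^ k - 2<..<4 * 2 ^ k - 3 / 2} \<longrightarrow> \<not> S (2 * l + 4) (\<Theta> - 2 * real m')"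
    using Suc.IH[OF _ m'] Suc.prems by (simp only: l(2))
  moreover have "AE \<Theta> in lebesgue. \<Theta> + (- 2 * real m) \<in> {0..horizon N} \<longrightarrow> S (2 * l + 2) (\<Theta> + (- 2 * real m)) \<longrightarrow>
    S (2 * l + 4) (\<Theta> + (- 2 * real m)) \<and> S (2 * l + 4) (\<Theta> + (- 2 * real m) + chain_shift k l)"
    using l by (intro AE_lebesgue_translate chain_step) auto
  ultimately show ?case
  proof eventually_elim
    case (elim \<Theta>)
    show ?case
    proof (intro impI notI)
      assume *: "\<Theta> \<in> {4 * 2 ^ k - 2<..<4 * 2 ^ k - 3 / 2}"
        and "S (2 * (2 * k - Suc i) + 2) (\<Theta> - 2 * real m)"
      then have "S (2 * l + 2) (\<Theta> + (- 2 * real m))" by (simp add: l_def)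
      moreover have "\<Theta> + (- 2 * real m) \<in> {0..horizon N}"
        using * small K by (auto simp del: of_nat_less_numeral_power_cancel_iff)
      ultimately have S: "S (2 * l + 4) (\<Theta> - 2 * real m)" "S (2 * l + 4) (\<Theta> - (2 * real m - chain_shift k l))"
        using elim(2) by (auto simp: algebra_simps)
      show False
      proof (cases "m < 2 ^ i")
        case True
        then show ?thesis using S elim(1) * by (simp add: m'_def)
      next
        case False
        then have "2 * real m - chain_shift k l = 2 * real m'"
          by (simp add: m'_def sh of_nat_diff)
        then show ?thesis using S(2) elim(1) * by simp
      qed
    qed
  qed
qed

text \<open>With \<open>h = 2 * 2 ^ k\<close>, the vertex \<open>u\<^sub>k\<close> is on the source
  side somewhere in \<open>(h - 1 + 2 * j, h + 2 * j)\<close> and on the sink side somewhere in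
  \<open>(h + 2 * j, h + 2 * j + 1 / 2)\<close>. Both lie in the \<open>j\<close>-th of
  \<open>2 ^ k\<close> disjoint windows.\<close>

lemma middle_changes: "enat (2 ^ k) \<le> num_changes (S (2 * k + 2)) {0<..<horizon N}"
proof (rule num_changes_ge)
  let ?B = "\<lambda>j::nat. {2 * 2 ^ k - 1 + 2 * real j<..<2 * 2 ^ k + 1 + 2 * real j}"
  show "disjoint_family_on ?B {..<2 ^ k}"
  proof (unfold disjoint_family_on_def, intro ballI impI)
    fix i j :: nat assume "i \<noteq> j"
    then have "real i + 1 \<le> real j \<or> real j + 1 \<le> real i" by linarith
    then show "?B i \<inter> ?B j = {}" by auto
  qed
  fix j :: nat assume j: "j < 2 ^ k"
  \<comment> \<open>The complementary index: going back by \<open>2 * m\<close> from the final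
    window lands right after the forward window shifted by \<open>2 * j\<close>.\<close>
  define m where "m = 2 ^ k - 1 - j"
  have m: "m < 2 ^ k" "real m = 2 ^ k - 1 - real j" using j by (auto simp: m_def of_nat_diff)
  have jr: "real j + 1 \<le> 2 ^ k" using j by (metis Suc_leI of_nat_Suc add.commute of_nat_le_numeral_power_cancel_iff)
  \<comment> \<open>Change points need actual points; an interval of positive length is not a null
    set, so almost-everywhere statements provide them.\<close>
  have witness: "\<exists>x\<in>{c<..<d}. P x" if "AE x in lebesgue. x \<in> {c<..<d} \<longrightarrow> P x" "c < d" for c d :: real and P
  proof (rule ccontr)
    assume "\<not> ?thesis"
    with that(1) have "AE x in lebesgue. x \<notin> {c<..<d}" by (auto elim!: eventually_mono)
    then have "{c<..<d} \<in> null_sets lebesgue" by (subst (asm) AE_iff_null_sets[symmetric]) auto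
    then show False using that(2) by (auto simp: null_sets_def)
  qed
  obtain x where x: "x \<in> {2 * 2 ^ k - 1<..<2 * 2 ^ k}" "S (2 * k + 2) (x + 2 * real j)"
    using witness[OF forward_forced[of k j]] j by auto
  obtain y where y: "y \<in> {4 * 2 ^ k - 2<..<4 * 2 ^ k - 3 / 2}" "\<not> S (2 * k + 2) (y - 2 * real m)"
    using witness[OF backward_forced[of k m]] m by auto
  have "x + 2 * real j < y - 2 * real m" using x(1) y(1) m(2) by auto
  moreover have "{x + 2 * real j..y - 2 * real m} \<subseteq> {0<..<horizon N}"
    using x(1) y(1) m(2) jr K by auto
  ultimately obtain \<theta> where "\<theta> \<in> change_points (S (2 * k + 2)) {0<..<horizon N}"
    "\<theta> \<in> {x + 2 * real j..y - 2 * real m}"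
    using x(2) y(2) change_point_between[of "x + 2 * real j" "y - 2 * real m" "S (2 * k + 2)" "{0<..<horizon N}"]
    by metis
  moreover have "{x + 2 * real j..y - 2 * real m} \<subseteq> ?B j"
    using x(1) y(1) m(2) by auto
  ultimately show "\<exists>\<theta>\<in>change_points (S (2 * k + 2)) {0<..<horizon N}. \<theta> \<in> ?B j" by blast
qed

lemma min_cut_complexity: "ereal_of_enat (cut_complexity N S) \<ge> ereal (2 ^ k)"
proof -
  have "enat (2 ^ k) \<le> cut_complexity N S"
    unfolding cut_complexity_def
    using middle_changes
    by (rule order_trans) (rule member_le_sum, auto)
  then have "ereal_of_enat (enat (2 ^ k)) \<le> ereal_of_enat (cut_complexity N S)"
    by (simp only: ereal_of_enat_le_iff)
  then show ?thesis by simp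
qed

end

section \<open>Acyclicity, size and flow complexity\<close>

text \<open>Every edge leads to a vertex with a larger number.\<close>

lemma acyclic: "acyclic (edges N)"
proof (rule acyclic_subset)
  show "acyclic less_than" using wf_less_than by (rule wf_acyclic)
  show "edges N \<subseteq> less_than" by (auto simp: flow_edges_def chain_edges_def)
qed

text \<open>There are \<open>4 * k + 4\<close> vertices, six flow edges and at most three edges for
  each of the \<open>2 * k\<close> links of the chain.\<close>

lemma size: "net_size N \<le> 10 * k + 10"
proof -
  have "card (chain_edges k) \<le> (\<Sum>i<2 * k. 3)"
    unfolding chain_edges_def
    by (rule order_trans[OF card_UN_le sum_mono]) (auto simp: card_insert_if)
  moreover have "card (flow_edges k) \<le> 6"
    by (simp add: flow_edges_def card_insert_if)
  moreover have "card (edges N) \<le> card (flow_edges k) + card (chain_edges k)"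
    by (simp add: card_Un_le)
  ultimately show ?thesis by (simp add: net_size_def)
qed

text \<open>On each edge the flow is a constant multiple of the indicator of one interval, so it
  changes at most at the two ends.\<close>

lemma flow_complexity:
  "ereal_of_enat (flow_complexity N (chain_flow k)) \<le> ereal (2 * real (net_size N))"
proof -
  have "num_changes (chain_flow k e) UNIV \<le> enat 2" for e
  proof -
    have "\<exists>a b. change_points (chain_flow k e) UNIV \<subseteq> {a, b}"
    proof -
      define I where "I = active_interval k e"
      have "\<exists>a b. {a<..<b} \<subseteq> {x..<y} \<and> {x..<y} \<subseteq> {a..b}"
        "\<exists>a b. {a<..<b} \<subseteq> {x..y} \<and> {x..y} \<subseteq> {a..b}"
        "\<exists>a b. {a<..<b} \<subseteq> ({} :: real set) \<and> {} \<subseteq> {a..b}" for x y :: real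
        by (rule exI[of _ x], rule exI[of _ y], force)+ (auto intro!: exI[of _ 0])
      then have "\<exists>a b. {a<..<b} \<subseteq> I \<and> I \<subseteq> {a..b}"
        unfolding I_def active_interval_def by presburger
      then obtain a b where "{a<..<b} \<subseteq> I" "I \<subseteq> {a..b}" by blast
      then have "change_points (chain_flow k e) UNIV \<subseteq> {a, b}"
        by (intro change_points_bump[where c = 0 and d = "if e = (0, 1) then 2 else 1"])
          (force simp: chain_flow_def I_def[symmetric] indicator_def)+
      then show ?thesis by blast
    qed
    then obtain a b where ab: "change_points (chain_flow k e) UNIV \<subseteq> {a, b}" by blast
    then have "finite (change_points (chain_flow k e) UNIV)" by (rule finite_subset) simp
    moreover have "card (change_points (chain_flow k e) UNIV) \<le> 2"
      using card_mono[OF _ ab] card_insert_le_m1[of 2 "{b}" a] by simp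
    ultimately show ?thesis by (simp add: num_changes_def)
  qed
  then have "flow_complexity N (chain_flow k) \<le> (\<Sum>e\<in>edges N. enat 2)"
    unfolding flow_complexity_def by (intro sum_mono)
  also have "\<dots> = enat (2 * card (edges N))"
    by (simp add: of_nat_eq_enat[symmetric] mult.commute del: net_simps)
  also have "\<dots> \<le> enat (2 * net_size N)"
    by (simp add: net_size_def)
  finally have "ereal_of_enat (flow_complexity N (chain_flow k)) \<le> ereal_of_enat (enat (2 * net_size N))"
    by (simp only: ereal_of_enat_le_iff)
  then show ?thesis by simp
qed

end

section \<open>Both variants of the theorem\<close>

lemma exp_min_cuts_lin_max_flowI:
  assumes "\<And>k. k \<ge> 1 \<Longrightarrow> chain_net k (b k) (u k) \<and> P (chain_network k (b k) (u k))"
  shows "exp_min_cuts_lin_max_flow P"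
  unfolding exp_min_cuts_lin_max_flow_def
\<comment> \<open>The witnesses are fixed by the goals shown below: \<open>p = 10\<close>,
  \<open>d = 1\<close>, \<open>c = 1\<close>, base \<open>2\<close> and
  \<open>C = 2\<close>.\<close>
proof (intro exI conjI allI impI)
  fix k :: nat assume k: "k \<ge> 1"
  interpret chain_net k "b k" "u k" using assms[OF k] by simp
  show "wf_network (chain_network k (b k) (u k))" by (rule wf)
  show "acyclic (edges (chain_network k (b k) (u k)))" by (rule acyclic)
  show "P (chain_network k (b k) (u k))" using assms[OF k] by simp
  show "net_size (chain_network k (b k) (u k)) \<le> 10 * k ^ 1 + 10" using size by simp
  show "min_cut (chain_network k (b k) (u k)) (chain_cut k)" by (rule min_cut)
  show "max_flow (chain_network k (b k) (u k)) (chain_flow k)" by (rule max_flow)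
  show "ereal (1 * 2 ^ k) \<le> ereal_of_enat (cut_complexity (chain_network k (b k) (u k)) S)"
    if "min_cut (chain_network k (b k) (u k)) S" for S
    using min_cut_complexity[OF that] by simp
  show "ereal_of_enat (flow_complexity (chain_network k (b k) (u k)) (chain_flow k))
      \<le> ereal (2 * real (net_size (chain_network k (b k) (u k))))" by (rule flow_complexity)
qed simp_all

theorem theorem6:
  shows "exp_min_cuts_lin_max_flow one_capacity_change \<and>
         exp_min_cuts_lin_max_flow one_transit_change"
proof
  have e0: "(0, 1) \<in> edges (chain_network k b u)" for k b u
    by (simp add: chain_network_def flow_edges_def)
  have h: "0 < (2::real) * 2 ^ k \<and> 2 * 2 ^ k < horizon (chain_network k b u)" if "k \<ge> 1" for k b u
    using power_increasing[of 1 k "2::real"] that by (simp add: chain_network_def)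
  show "exp_min_cuts_lin_max_flow one_capacity_change"
  \<comment> \<open>The capacity drops from \<open>2\<close> to \<open>0\<close>, while the transit
    time stays \<open>0\<close>.\<close>
  proof (rule exp_min_cuts_lin_max_flowI[where b = "\<lambda>_. 0" and u = "\<lambda>_. 0"])
    fix k :: nat assume k: "k \<ge> 1"
    have "chain_net k 0 0" using k by unfold_locales auto
    moreover have "one_capacity_change (chain_network k 0 0)"
      unfolding one_capacity_change_def
      by (intro conjI bexI[OF _ e0], use h[OF k] in \<open>auto simp: chain_network_def\<close>)
        (rule exI[of _ 2], rule exI[of _ 0], auto intro!: exI[of _ "2 * 2 ^ k"])
    ultimately show "chain_net k 0 0 \<and> one_capacity_change (chain_network k 0 0)" ..
  qed
  show "exp_min_cuts_lin_max_flow one_transit_change"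
  \<comment> \<open>The transit time jumps from \<open>0\<close> to a value beyond the horizon
    \<open>4 * 2 ^ k - 3 / 2\<close>, while the capacity stays \<open>2\<close>.\<close>
  proof (rule exp_min_cuts_lin_max_flowI[where b = "\<lambda>k. 4 * 2 ^ k" and u = "\<lambda>_. 2"])
    fix k :: nat assume k: "k \<ge> 1"
    have "chain_net k (4 * 2 ^ k) 2" using k by unfold_locales auto
    moreover have "one_transit_change (chain_network k (4 * 2 ^ k) 2)"
      unfolding one_transit_change_def
      by (intro conjI bexI[OF _ e0], use h[OF k] in \<open>auto simp: chain_network_def\<close>)
        (rule exI[of _ 0], rule exI[of _ "4 * 2 ^ k"], auto intro!: exI[of _ "2 * 2 ^ k"])
    ultimately show "chain_net k (4 * 2 ^ k) 2 \<and> one_transit_change (chain_network k (4 * 2 ^ k) 2)" ..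
  qed
qed

end
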